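(* Let $N,T,D\in\mathbb N$ and let $\mathbf z_{1:T}=(\mathbf z_t^n)_{t\in[T],n\in[N]_0}$ be fixed points of $\mathbb R^D$ with $\sum_{l_{1:T}\in[N]_0^T}\boldsymbol\pi_{T,D}(\mathbf z_1^{l_1},\dots,\mathbf z_T^{l_T})>0$. Let $\xi_T(\mathbf z_{1:T},\cdot)$ be the probability distribution on $[N]_0^T$ given by $$\xi_T(\mathbf z_{1:T},\{k_{1:T}\})=\frac{\boldsymbol\pi_{T,D}(\mathbf z_1^{k_1},\dots,\mathbf z_T^{k_T})}{\sum_{l_{1:T}\in[N]_0^T}\boldsymbol\pi_{T,D}(\mathbf z_1^{l_1},\dots,\mathbf z_T^{l_T})}.$$ Then the Markov kernel on $[N]_0^T$ which maps reference indices $j_{1:T}$ to new indices $K_{1:T}$ through the resampling, final-index-selection and backward-sampling steps of the i-RW-CSMC algorithm with backward sampling, as described in the context, leaves $\xi_T(\mathbf z_{1:T},\cdot)$ invariant.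
   Context: Notation: $[n]=\{1,\dots,n\}$, $[n]_0=\{0,\dots,n\}$. Quantities with time index $0$ are ignored (so $\mathbf m_1(\mathbf x_0,\mathbf x_1)\equiv\mathbf m_1(\mathbf x_1)$). Model: $\mathbf m_1$ is a probability density on $\mathbb R^D$; $\mathbf m_t(\mathbf x,\mathbf y)$, $t\ge2$, is a Markov transition density on $\mathbb R^D$; $\mathbf G_t:\mathbb R^D\to(0,\infty)$ is measurable; $\boldsymbol\pi_{T,D}(\mathbf x_{1:T})\propto\mathbf m_1(\mathbf x_1)\mathbf G_1(\mathbf x_1)\prod_{t=2}^T\mathbf m_t(\mathbf x_{t-1},\mathbf x_t)\mathbf G_t(\mathbf x_t)$ is a probability density on $(\mathbb R^D)^T$. The kernel $j_{1:T}\mapsto K_{1:T}$ (particles $\mathbf z_{1:T}$ fixed; $j_t$ is the index of the reference particle at time $t$): 1. For $t=1,\dots,T-1$: set $A_t^{j_{t+1}}=j_t$ and, conditionally independently for $n\in[N]_0\setminus\{j_{t+1}\}$, sample $A_t^n=l\in[N]_0$ with probability $\frac{\mathbf m_t(\mathbf z_{t-1}^{A_{t-1}^l},\mathbf z_t^l)\mathbf G_t(\mathbf z_t^l)}{\sum_{m=0}^N\mathbf m_t(\mathbf z_{t-1}^{A_{t-1}^m},\mathbf z_t^m)\mathbf G_t(\mathbf z_t^m)}$. 2. Sample $K_T=k\in[N]_0$ with probability $\frac{\mathbf m_T(\mathbf z_{T-1}^{A_{T-1}^k},\mathbf z_T^k)\mathbf G_T(\mathbf z_T^k)}{\sum_{m=0}^N\mathbf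 m_T(\mathbf z_{T-1}^{A_{T-1}^m},\mathbf z_T^m)\mathbf G_T(\mathbf z_T^m)}$. 3. For $t=T-1,\dots,1$ sample $K_t=k\in[N]_0$ with probability $\frac{\mathbf m_t(\mathbf z_{t-1}^{A_{t-1}^k},\mathbf z_t^k)\mathbf G_t(\mathbf z_t^k)\mathbf m_{t+1}(\mathbf z_t^k,\mathbf z_{t+1}^{K_{t+1}})}{\sum_{m=0}^N\mathbf m_t(\mathbf z_{t-1}^{A_{t-1}^m},\mathbf z_t^m)\mathbf G_t(\mathbf z_t^m)\mathbf m_{t+1}(\mathbf z_t^m,\mathbf z_{t+1}^{K_{t+1}})}$. These probabilities are well defined whenever $\xi_T(\mathbf z_{1:T},\{j_{1:T}\})>0$; for other $j_{1:T}$ the kernel may be defined arbitrarily. *)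

theory Defs
  imports "HOL-Probability.Probability" "HOL-Probability.Product_PMF"
begin

definition prob_density :: "'a measure \<Rightarrow> ('a \<Rightarrow> real) \<Rightarrow> bool" where
  "prob_density M f \<longleftrightarrow>
     f \<in> borel_measurable M \<and> (\<forall>x\<in>space M. 0 \<le> f x) \<and> (\<integral>\<^sup>+ x. ennreal (f x) \<partial>M) = 1"

definition markov_transition_density :: "(real^'d \<Rightarrow> real^'d \<Rightarrow> real) \<Rightarrow> bool" where
  "markov_transition_density q \<longleftrightarrow>
     case_prod q \<in> borel_measurable (borel \<Otimes>\<^sub>M borel) \<and> (\<forall>x. prob_density lborel (q x))"

text \<open>
  Paths in \<open>(\<real>\<^sup>D)\<^sup>T\<close> are functions on \<open>{1..T}\<close>. The density is normalised by the total mass of the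
  product below. If that mass is zero or infinite, \<open>target_density\<close> vanishes identically and is then
  not a \<^const>\<open>prob_density\<close>.
\<close>

definition unnormalised_target ::
  "(real^'d \<Rightarrow> real) \<Rightarrow> (nat \<Rightarrow> real^'d \<Rightarrow> real^'d \<Rightarrow> real) \<Rightarrow> (nat \<Rightarrow> real^'d \<Rightarrow> real) \<Rightarrow>
   nat \<Rightarrow> (nat \<Rightarrow> real^'d) \<Rightarrow> real" where
  "unnormalised_target m1 m G T x =
     m1 (x 1) * G 1 (x 1) * (\<Prod>t = 2..T. m t (x (t - 1)) (x t) * G t (x t))"

definition path_measure :: "nat \<Rightarrow> (nat \<Rightarrow> real^'d) measure" where
  "path_measure T = Pi\<^sub>M {1..T} (\<lambda>_. lborel)"

definition target_density ::
  "(real^'d \<Rightarrow> real) \<Rightarrow> (nat \<Rightarrow> real^'d \<Rightarrow> real^'d \<Rightarrow> real) \<Rightarrow> (nat \<Rightarrow> real^'d \<Rightarrow> real) \<Rightarrow>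
   nat \<Rightarrow> (nat \<Rightarrow> real^'d) \<Rightarrow> real" where
  "target_density m1 m G T x =
     unnormalised_target m1 m G T x / (\<integral>y. unnormalised_target m1 m G T y \<partial>path_measure T)"

definition index_paths :: "nat \<Rightarrow> nat \<Rightarrow> (nat \<Rightarrow> nat) set" where
  "index_paths N T = {1..T} \<rightarrow>\<^sub>E {0..N}"

text \<open>Particles are written \<open>z t n\<close> for the \<open>n\<close>-th particle at time \<open>t\<close>.\<close>

definition select_path :: "nat \<Rightarrow> (nat \<Rightarrow> nat \<Rightarrow> real^'d) \<Rightarrow> (nat \<Rightarrow> nat) \<Rightarrow> nat \<Rightarrow> real^'d" where
  "select_path T z k = (\<lambda>t\<in>{1..T}. z t (k t))"

text \<open>
  The distribution on a finite set \<open>I\<close> proportional to \<open>w\<close>. It is meaningful only for nonnegative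
  weights with a positive sum; otherwise it is some unspecified distribution.
\<close>

definition normalised_pmf :: "'i set \<Rightarrow> ('i \<Rightarrow> real) \<Rightarrow> 'i pmf" where
  "normalised_pmf I w = embed_pmf (\<lambda>i. if i \<in> I then w i / (\<Sum>m\<in>I. w m) else 0)"

lemma pmf_normalised_pmf:
  assumes "finite I" and "\<And>i. i \<in> I \<Longrightarrow> 0 \<le> w i" and "0 < (\<Sum>m\<in>I. w m)"
  shows "pmf (normalised_pmf I w) i = (if i \<in> I then w i / (\<Sum>m\<in>I. w m) else 0)"
proof -
  let ?f = "\<lambda>i. if i \<in> I then w i / (\<Sum>m\<in>I. w m) else 0"
  have nn: "0 \<le> ?f i" for i
    using assms by (auto intro!: divide_nonneg_pos)
  have "(\<integral>\<^sup>+ i. ennreal (?f i) \<partial>count_space UNIV) = (\<integral>\<^sup>+ i. ennreal (?f i) \<partial>count_space I)"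
    by (subst nn_integral_count_space_indicator)
       (auto intro!: nn_integral_cong simp: indicator_def)
  also have "\<dots> = (\<Sum>i\<in>I. ennreal (?f i))"
    using assms(1) by (rule nn_integral_count_space_finite)
  also have "\<dots> = ennreal (\<Sum>i\<in>I. ?f i)"
    by (rule sum_ennreal) (rule nn)
  also have "(\<Sum>i\<in>I. ?f i) = 1"
    using assms(3) by (simp add: sum_divide_distrib[symmetric])
  finally have "(\<integral>\<^sup>+ i. ennreal (?f i) \<partial>count_space UNIV) = 1" by simp
  then show ?thesis
    unfolding normalised_pmf_def by (subst pmf_embed_pmf) (use nn in auto)
qed

definition index_target ::
  "(real^'d \<Rightarrow> real) \<Rightarrow> (nat \<Rightarrow> real^'d \<Rightarrow> real^'d \<Rightarrow> real) \<Rightarrow> (nat \<Rightarrow> real^'d \<Rightarrow> real) \<Rightarrow>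
   nat \<Rightarrow> nat \<Rightarrow> (nat \<Rightarrow> nat \<Rightarrow> real^'d) \<Rightarrow> (nat \<Rightarrow> nat) pmf" where
  "index_target m1 m G N T z =
     normalised_pmf (index_paths N T) (\<lambda>k. target_density m1 m G T (select_path T z k))"

text \<open>
  \<open>particle_weight m1 m G z t a n\<close> is the weight of particle \<open>n\<close> at time \<open>t\<close>, where \<open>a\<close> is the vector
  of ancestor indices at time \<open>t - 1\<close>. It does not depend on \<open>a\<close> if \<open>t = 1\<close>.
\<close>

definition particle_weight ::
  "(real^'d \<Rightarrow> real) \<Rightarrow> (nat \<Rightarrow> real^'d \<Rightarrow> real^'d \<Rightarrow> real) \<Rightarrow> (nat \<Rightarrow> real^'d \<Rightarrow> real) \<Rightarrow>
   (nat \<Rightarrow> nat \<Rightarrow> real^'d) \<Rightarrow> nat \<Rightarrow> (nat \<Rightarrow> nat) \<Rightarrow> nat \<Rightarrow> real" where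
  "particle_weight m1 m G z t a n =
     (if t = 1 then m1 (z t n) else m t (z (t - 1) (a n)) (z t n)) * G t (z t n)"

text \<open>
  The joint law of the ancestor indices \<open>A s n\<close> for \<open>1 \<le> s \<le> t\<close> and \<open>n \<le> N\<close>, given the reference
  indices \<open>j\<close>. The values of \<open>A\<close> at other arguments are dummies that are never used.
\<close>

primrec resampling ::
  "(real^'d \<Rightarrow> real) \<Rightarrow> (nat \<Rightarrow> real^'d \<Rightarrow> real^'d \<Rightarrow> real) \<Rightarrow> (nat \<Rightarrow> real^'d \<Rightarrow> real) \<Rightarrow>
   nat \<Rightarrow> (nat \<Rightarrow> nat \<Rightarrow> real^'d) \<Rightarrow> (nat \<Rightarrow> nat) \<Rightarrow> nat \<Rightarrow> (nat \<Rightarrow> nat \<Rightarrow> nat) pmf" where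
  "resampling m1 m G N z j 0 = return_pmf (\<lambda>_ _. 0)"
| "resampling m1 m G N z j (Suc t) =
     bind_pmf (resampling m1 m G N z j t) (\<lambda>A.
     bind_pmf (Pi_pmf {0..N} 0 (\<lambda>n.
         if n = j (Suc t + 1) then return_pmf (j (Suc t))
         else normalised_pmf {0..N} (particle_weight m1 m G z (Suc t) (A t)))) (\<lambda>a.
     return_pmf (A(Suc t := a))))"

text \<open>Given ancestor indices \<open>A\<close> and \<open>K s\<close> for \<open>s > t\<close>, sample \<open>K t, \<dots>, K 1\<close> in this order.\<close>

primrec backward_sampling ::
  "(real^'d \<Rightarrow> real) \<Rightarrow> (nat \<Rightarrow> real^'d \<Rightarrow> real^'d \<Rightarrow> real) \<Rightarrow> (nat \<Rightarrow> real^'d \<Rightarrow> real) \<Rightarrow>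
   nat \<Rightarrow> (nat \<Rightarrow> nat \<Rightarrow> real^'d) \<Rightarrow> (nat \<Rightarrow> nat \<Rightarrow> nat) \<Rightarrow> nat \<Rightarrow> (nat \<Rightarrow> nat) \<Rightarrow> (nat \<Rightarrow> nat) pmf"
where
  "backward_sampling m1 m G N z A 0 K = return_pmf K"
| "backward_sampling m1 m G N z A (Suc t) K =
     bind_pmf (normalised_pmf {0..N} (\<lambda>k.
         particle_weight m1 m G z (Suc t) (A t) k *
         m (Suc t + 1) (z (Suc t) k) (z (Suc t + 1) (K (Suc t + 1))))) (\<lambda>k.
     backward_sampling m1 m G N z A t (K(Suc t := k)))"

definition csmc_backward_kernel ::
  "(real^'d \<Rightarrow> real) \<Rightarrow> (nat \<Rightarrow> real^'d \<Rightarrow> real^'d \<Rightarrow> real) \<Rightarrow> (nat \<Rightarrow> real^'d \<Rightarrow> real) \<Rightarrow>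
   nat \<Rightarrow> nat \<Rightarrow> (nat \<Rightarrow> nat \<Rightarrow> real^'d) \<Rightarrow> (nat \<Rightarrow> nat) \<Rightarrow> (nat \<Rightarrow> nat) pmf" where
  "csmc_backward_kernel m1 m G N T z j =
     bind_pmf (resampling m1 m G N z j (T - 1)) (\<lambda>A.
     bind_pmf (normalised_pmf {0..N} (particle_weight m1 m G z T (A (T - 1)))) (\<lambda>k.
     backward_sampling m1 m G N z A (T - 1) ((\<lambda>_. undefined)(T := k))))"

end

theory Submission
  imports Defs
begin

text \<open>
  Let \<open>j\<close> be distributed according to the unnormalised target and let \<open>A\<close> be the ancestors sampled
  given \<open>j\<close>. By induction on \<open>t\<close>, conditionally on the ancestors up to time \<open>t - 1\<close>, the index
  \<open>j t\<close> is a draw from the normalised weights at time \<open>t\<close>. Hence the forced choice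
  \<open>A t (j (t + 1)) = j t\<close> looks like a genuine multinomial resampling step, up to the factor
  \<open>m (t + 1) \<sqdot> G (t + 1)\<close>. Integrating out the ancestors backwards in time, this factor turns the
  normalising constant of each backward sampling step into the next factor of the target.
  The unspecified values of \<^const>\<open>normalised_pmf\<close> do no harm: wherever all weights vanish, the
  distribution is multiplied by a vanishing factor.
\<close>

section \<open>Normalised weights and product distributions\<close>

lemma set_normalised_pmf_subset:
  assumes "finite I" and "\<And>i. i \<in> I \<Longrightarrow> 0 \<le> w i" and "0 < (\<Sum>k\<in>I. w k)"
  shows "set_pmf (normalised_pmf I w) \<subseteq> I"
  by (auto simp: set_pmf_eq pmf_normalised_pmf[OF assms] split: if_splits)

text \<open>Only the draw \<open>i\<close> can lead to \<open>x\<close>, so the mixture has a single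
  term. The equation is multiplied out by the total weight: when that is zero, \<open>w i\<close> is
  zero too, and the unspecified value of \<open>normalised_pmf\<close> drops out.\<close>

lemma pmf_bind_normalised_pmf_single:
  assumes "finite I" and w: "\<And>i. i \<in> I \<Longrightarrow> 0 \<le> w i" and "i \<in> I"
    and zero: "\<And>k. k \<in> I \<Longrightarrow> k \<noteq> i \<Longrightarrow> pmf (f k) x = 0"
  shows "(\<Sum>k\<in>I. w k) * pmf (bind_pmf (normalised_pmf I w) f) x = w i * pmf (f i) x"
proof (cases "(\<Sum>k\<in>I. w k) = 0")
  case True
  then have "w i = 0"
    using assms by (simp add: sum_nonneg_eq_0_iff)
  with True show ?thesis by simp
next
  case False
  then have pos: "0 < (\<Sum>k\<in>I. w k)"
    using sum_nonneg[of I w] w by (auto simp: less_le)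
  note pmf = pmf_normalised_pmf[of I w, OF assms(1) w pos]
  have "pmf (bind_pmf (normalised_pmf I w) f) x =
      (\<Sum>k\<in>I. pmf (f k) x * pmf (normalised_pmf I w) k)"
    unfolding pmf_bind using set_normalised_pmf_subset[OF assms(1) w pos] assms(1)
    by (intro integral_measure_pmf_real) auto
  also have "\<dots> = (\<Sum>k\<in>I. if k = i then pmf (f i) x * (w i / (\<Sum>k\<in>I. w k)) else 0)"
    by (intro sum.cong refl) (auto simp: pmf zero)
  also have "\<dots> = pmf (f i) x * (w i / (\<Sum>k\<in>I. w k))"
    using assms by simp
  finally show ?thesis
    using False by simp
qed

text \<open>Multiplied out, the cancellation also covers a zero total, where nonnegativity makes
  every \<open>w k\<close> zero.\<close>

lemma sum_normalised_weights:
  fixes w h :: "'i \<Rightarrow> real"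
  assumes "finite I" and "\<And>i. i \<in> I \<Longrightarrow> 0 \<le> w i"
  shows "(\<Sum>i\<in>I. w i) * (\<Sum>k\<in>I. w k / (\<Sum>l\<in>I. w l) * h k) = (\<Sum>k\<in>I. w k * h k)"
proof (cases "(\<Sum>k\<in>I. w k) = 0")
  case True
  then have "w k = 0" if "k \<in> I" for k
    using assms that by (simp add: sum_nonneg_eq_0_iff)
  with True show ?thesis by simp
next
  case False
  then show ?thesis
    by (simp add: sum_distrib_left)
qed

text \<open>The coordinates are independent, so coordinate \<open>k\<close> may be drawn first. This
  makes the forced ancestor of the reference particle an ordinary draw once the reference index is
  itself random with law \<open>p\<close>.\<close>

lemma Pi_pmf_condition_coordinate:
  assumes "finite I" and "k \<in> I"
  shows "bind_pmf p (\<lambda>i. Pi_pmf I d (\<lambda>n. if n = k then return_pmf i else p)) = Pi_pmf I d (\<lambda>_. p)"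
proof -
  have ins: "Pi_pmf I d q =
      bind_pmf (q k) (\<lambda>i. bind_pmf (Pi_pmf (I - {k}) d q) (\<lambda>f. return_pmf (f(k := i))))" for q
    using Pi_pmf_insert'[of "I - {k}" k d q] assms by (simp add: insert_absorb)
  have "Pi_pmf (I - {k}) d (\<lambda>n. if n = k then return_pmf i else p) = Pi_pmf (I - {k}) d (\<lambda>_. p)" for i
    by (rule Pi_pmf_cong) auto
  then have "Pi_pmf I d (\<lambda>n. if n = k then return_pmf i else p) =
      bind_pmf (Pi_pmf (I - {k}) d (\<lambda>_. p)) (\<lambda>f. return_pmf (f(k := i)))" for i
    by (simp add: ins[of "\<lambda>n. if n = k then return_pmf i else p"] bind_return_pmf)
  then show ?thesis
    by (simp add: ins[of "\<lambda>_. p"])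
qed

text \<open>Under the forced law \<open>a k = i\<close> holds almost surely, so \<open>F i\<close>
  moves inside the expectation as \<open>F (a k)\<close>; \<open>Pi_pmf_condition_coordinate\<close>
  then removes the forcing.\<close>

lemma expectation_Pi_pmf_condition_coordinate:
  fixes f :: "('i \<Rightarrow> 'j) \<Rightarrow> real"
  assumes "finite I" and "k \<in> I" and "finite J" and "set_pmf p \<subseteq> J"
  shows "(\<Sum>i\<in>J. pmf p i * (F i *
           measure_pmf.expectation (Pi_pmf I d (\<lambda>n. if n = k then return_pmf i else p)) f)) =
         measure_pmf.expectation (Pi_pmf I d (\<lambda>_. p)) (\<lambda>a. F (a k) * f a)"
proof -
  have fp: "finite (set_pmf p)"
    using assms finite_subset by blast
  have "measure_pmf.expectation (Pi_pmf I d (\<lambda>n. if n = k then return_pmf i else p)) (\<lambda>a. F (a k) * f a) =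
      F i * measure_pmf.expectation (Pi_pmf I d (\<lambda>n. if n = k then return_pmf i else p)) f" for i
    unfolding Bochner_Integration.integral_mult_right_zero[symmetric]
    by (intro integral_cong_AE)
       (use assms in \<open>auto simp: AE_measure_pmf_iff set_Pi_pmf PiE_dflt_def\<close>)
  moreover have "finite (set_pmf (Pi_pmf I d (\<lambda>n. if n = k then return_pmf i else p)))" for i
    using assms fp by (auto simp: set_Pi_pmf intro!: finite_PiE_dflt)
  ultimately show ?thesis
    using assms
    by (subst Pi_pmf_condition_coordinate[OF assms(1,2), symmetric], subst pmf_expectation_bind[of J]) auto
qed

text \<open>Boundedness takes the place of finite support: when all weights vanish, nothing is known
  about the support of \<open>normalised_pmf\<close>.\<close>

lemma expectation_bind_pmf_bounded:
  fixes f :: "'b \<Rightarrow> real"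
  assumes "\<And>x. \<bar>f x\<bar> \<le> B"
  shows "measure_pmf.expectation (bind_pmf p q) f =
    measure_pmf.expectation p (\<lambda>x. measure_pmf.expectation (q x) f)"
proof -
  have "measure_pmf.expectation (bind_pmf p q) f =
      (\<integral>x. f x \<partial>(measure_pmf p \<bind> (\<lambda>x. measure_pmf (q x))))"
    by (simp add: measure_pmf_bind)
  also have "\<dots> = measure_pmf.expectation p (\<lambda>x. measure_pmf.expectation (q x) f)"
    by (rule integral_bind[where K = "count_space UNIV" and B = B and B' = 1])
       (use assms in \<open>auto simp: measurable_def measure_pmf_in_subprob_algebra measure_pmf.emeasure_space_1\<close>)
  finally show ?thesis .
qed

lemma abs_expectation_le:
  fixes f :: "'a \<Rightarrow> real"
  assumes "\<And>x. \<bar>f x\<bar> \<le> B"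
  shows "\<bar>measure_pmf.expectation p f\<bar> \<le> B"
proof -
  have int: "integrable (measure_pmf p) f"
    using assms by (intro measure_pmf.integrable_const_bound[where B = B]) auto
  have "-B \<le> f x" "f x \<le> B" for x
    using assms[of x] by auto
  then have "measure_pmf.expectation p f \<le> B" "-B \<le> measure_pmf.expectation p f"
    by (auto intro!: measure_pmf.integral_le_const measure_pmf.integral_ge_const int)
  then show ?thesis by simp
qed

section \<open>Sums over index paths and factorisation of the target\<close>

lemma finite_index_paths [simp]: "finite (index_paths N T)"
  by (simp add: index_paths_def finite_PiE)

lemma sum_index_paths_Suc:
  fixes f :: "(nat \<Rightarrow> nat) \<Rightarrow> real"
  shows "(\<Sum>j\<in>index_paths N (Suc n). f j) =
    (\<Sum>j\<in>index_paths N n. \<Sum>k\<in>{0..N}. f (j(Suc n := k)))"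
proof -
  have "{1..Suc n} = insert (Suc n) {1..n}" by auto
  then have "(\<Sum>j\<in>index_paths N (Suc n). f j) =
      (\<Sum>p\<in>{0..N} \<times> index_paths N n. f ((snd p)(Suc n := fst p)))"
    unfolding index_paths_def
    by (simp only: PiE_insert_eq, subst sum.reindex)
       (auto intro: inj_combinator simp: case_prod_beta)
  also have "\<dots> = (\<Sum>k\<in>{0..N}. \<Sum>j\<in>index_paths N n. f (j(Suc n := k)))"
    unfolding sum.cartesian_product by (simp add: case_prod_beta)
  finally show ?thesis
    by (simp only: sum.swap[of _ "{0..N}"])
qed

lemma unnormalised_target_Suc:
  "unnormalised_target m1 m G (Suc (Suc n)) y =
     unnormalised_target m1 m G (Suc n) y *
     (m (Suc (Suc n)) (y (Suc n)) (y (Suc (Suc n))) * G (Suc (Suc n)) (y (Suc (Suc n))))"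
  by (simp add: unnormalised_target_def)

lemma unnormalised_target_cong:
  assumes "1 \<le> T" and "\<And>t. t \<in> {1..T} \<Longrightarrow> y t = y' t"
  shows "unnormalised_target m1 m G T y = unnormalised_target m1 m G T y'"
proof -
  have "y 1 = y' 1"
    using assms by auto
  moreover have "y t = y' t" "y (t - 1) = y' (t - 1)" if "t \<in> {2..T}" for t
    using that by (auto intro!: assms(2))
  then have "(\<Prod>t = 2..T. m t (y (t - 1)) (y t) * G t (y t)) =
      (\<Prod>t = 2..T. m t (y' (t - 1)) (y' t) * G t (y' t))"
    by (intro prod.cong refl) (simp only:)
  ultimately show ?thesis
    by (simp only: unnormalised_target_def)
qed

section \<open>Which indices the two samplers read\<close>

text \<open>The range ends at \<open>Suc n\<close> because resampling at time \<open>n\<close> reads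
  \<open>j (Suc n)\<close> to find the forced slot.\<close>

lemma resampling_cong:
  assumes "\<And>t. t \<in> {1..Suc n} \<Longrightarrow> j t = j' t"
  shows "resampling m1 m G N z j n = resampling m1 m G N z j' n"
  using assms
proof (induction n)
  case (Suc n)
  have "resampling m1 m G N z j n = resampling m1 m G N z j' n"
    by (rule Suc.IH) (use Suc.prems in auto)
  moreover have "j (Suc n) = j' (Suc n)" "j (Suc (Suc n)) = j' (Suc (Suc n))"
    using Suc.prems by auto
  ultimately show ?case by (simp cong: if_cong)
qed simp

text \<open>Drawing \<open>K t\<close> uses the ancestors at time \<open>t - 1\<close> only, and the
  initial values of \<open>K\<close> on \<open>{1..n}\<close> are overwritten before they are
  read.\<close>

lemma backward_sampling_cong:
  assumes "\<And>t. t \<le> n \<Longrightarrow> 0 < t \<Longrightarrow> A (t - 1) = A' (t - 1)" and "\<And>t. t \<notin> {1..n} \<Longrightarrow> K t = K' t"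
  shows "backward_sampling m1 m G N z A n K = backward_sampling m1 m G N z A' n K'"
  using assms
proof (induction n arbitrary: K K')
  case 0
  then have "K = K'" by auto
  then show ?case by simp
next
  case (Suc n)
  have "backward_sampling m1 m G N z A n (K(Suc n := k)) =
      backward_sampling m1 m G N z A' n (K'(Suc n := k))" for k
    by (rule Suc.IH) (use Suc.prems in auto)
  moreover have "K (Suc (Suc n)) = K' (Suc (Suc n))"
    using Suc.prems(2) by auto
  moreover have "particle_weight m1 m G z (Suc n) (A n) = particle_weight m1 m G z (Suc n) (A' n)"
    using Suc.prems(1)[of "Suc n"] by (simp add: particle_weight_def fun_eq_iff)
  then have "particle_weight m1 m G z (Suc n) (A n) k = particle_weight m1 m G z (Suc n) (A' n) k" for k
    by simp
  ultimately show ?case by simp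
qed

text \<open>Coordinates outside \<open>{1..n}\<close> are never overwritten, so a mismatch there
  persists. With \<open>t\<close> the coordinate just drawn, this supplies the vanishing condition
  of \<open>pmf_bind_normalised_pmf_single\<close>.\<close>

lemma pmf_backward_sampling_eq_0:
  assumes "t \<notin> {1..n}" and "K t \<noteq> x t"
  shows "pmf (backward_sampling m1 m G N z A n K) x = 0"
  using assms
proof (induction n arbitrary: K)
  case 0
  then have "K \<noteq> x" by auto
  then show ?case by simp
next
  case (Suc n)
  then have "pmf (backward_sampling m1 m G N z A n (K(Suc n := k))) x = 0" for k
    by (intro Suc.IH) auto
  then show ?case by (simp add: pmf_bind)
qed

section \<open>The unnormalised joint law of ancestors and reference index\<close>

locale conditional_smc =
  fixes m1 :: "real^'d \<Rightarrow> real"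
    and m :: "nat \<Rightarrow> real^'d \<Rightarrow> real^'d \<Rightarrow> real"
    and G :: "nat \<Rightarrow> real^'d \<Rightarrow> real"
    and N T :: nat
    and z :: "nat \<Rightarrow> nat \<Rightarrow> real^'d"
  assumes m1_nonneg: "0 \<le> m1 x"
    and m_nonneg: "t \<in> {2..T} \<Longrightarrow> 0 \<le> m t x y"
    and G_nonneg: "t \<in> {1..T} \<Longrightarrow> 0 \<le> G t x"
begin

abbreviation weight :: "nat \<Rightarrow> (nat \<Rightarrow> nat) \<Rightarrow> nat \<Rightarrow> real" where
  "weight \<equiv> particle_weight m1 m G z"

text \<open>Division by zero gives \<open>0\<close>, so \<open>nweight\<close> vanishes when the
  total weight is zero, whereas \<open>normalised_pmf\<close> is then unspecified.\<close>

definition nweight :: "nat \<Rightarrow> (nat \<Rightarrow> nat) \<Rightarrow> nat \<Rightarrow> real" where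
  "nweight t a k = weight t a k / (\<Sum>l\<in>{0..N}. weight t a l)"

definition path_weight :: "nat \<Rightarrow> (nat \<Rightarrow> nat) \<Rightarrow> real" where
  "path_weight t k = unnormalised_target m1 m G t (\<lambda>s. z s (k s))"

text \<open>
  The law of the ancestors of all particles at time \<open>t + 1\<close>, where the reference path passes through
  particle \<open>i\<close> at time \<open>t\<close> and through particle \<open>k\<close> at time \<open>t + 1\<close>.
\<close>

definition ancestors :: "nat \<Rightarrow> (nat \<Rightarrow> nat) \<Rightarrow> nat \<Rightarrow> nat \<Rightarrow> (nat \<Rightarrow> nat) pmf" where
  "ancestors t a i k = Pi_pmf {0..N} 0
     (\<lambda>n. if n = k then return_pmf i else normalised_pmf {0..N} (weight t a))"

definition step :: "nat \<Rightarrow> nat \<Rightarrow> nat \<Rightarrow> real" where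
  "step t i k = m t (z (t - 1) i) (z t k) * G t (z t k)"

text \<open>
  Integration against the unnormalised joint law of the ancestors up to time \<open>n\<close> and the reference
  index at time \<open>n + 1\<close>; see \<open>sum_path_weight_resampling\<close> below.
\<close>

primrec joint_sum :: "nat \<Rightarrow> ((nat \<Rightarrow> nat \<Rightarrow> nat) \<Rightarrow> nat \<Rightarrow> real) \<Rightarrow> real" where
  "joint_sum 0 h = (\<Sum>i\<in>{0..N}. weight 1 (\<lambda>_. 0) i * h (\<lambda>_ _. 0) i)"
| "joint_sum (Suc n) h = joint_sum n (\<lambda>A i. \<Sum>k\<in>{0..N}. step (Suc (Suc n)) i k *
     measure_pmf.expectation (ancestors (Suc n) (A n) i k) (\<lambda>a. h (A(Suc n := a)) k))"

lemma weight_nonneg: "t \<in> {1..T} \<Longrightarrow> 0 \<le> weight t a k"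
  using m1_nonneg m_nonneg[of t] G_nonneg[of t] by (auto simp: particle_weight_def)

lemma weight_Suc_Suc: "weight (Suc (Suc n)) a k = step (Suc (Suc n)) (a k) k"
  by (simp add: particle_weight_def step_def)

lemma path_weight_1: "path_weight (Suc 0) k = weight 1 a (k 1)"
  by (simp add: path_weight_def unnormalised_target_def particle_weight_def)

lemma path_weight_Suc:
  "path_weight (Suc (Suc n)) k =
     path_weight (Suc n) k * step (Suc (Suc n)) (k (Suc n)) (k (Suc (Suc n)))"
  by (simp add: path_weight_def unnormalised_target_Suc step_def)

lemma path_weight_upd: "path_weight (Suc n) (k(Suc (Suc n) := i)) = path_weight (Suc n) k"
  unfolding path_weight_def by (rule unnormalised_target_cong) auto

lemma path_weight_nonneg: "1 \<le> T \<Longrightarrow> 0 \<le> path_weight T k"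
  using m1_nonneg m_nonneg G_nonneg
  by (auto simp: path_weight_def unnormalised_target_def intro!: mult_nonneg_nonneg prod_nonneg)

lemma joint_sum_mult: "joint_sum n (\<lambda>A i. c * h A i) = c * joint_sum n h"
proof (induction n arbitrary: h)
  case 0
  show ?case by (simp add: sum_distrib_left mult_ac)
next
  case (Suc n)
  show ?case
    unfolding joint_sum.simps Suc.IH[symmetric]
    by (simp add: sum_distrib_left mult_ac)
qed

text \<open>Averaging over \<open>i\<close> turns the forced ancestor into a genuine draw, so all
  ancestors become independent with the same law, and \<open>step\<close> from the ancestor of
  \<open>k\<close> is the weight of \<open>k\<close>. The right-hand side depends on
  \<open>f\<close> only through a weighted sum over \<open>k\<close>.\<close>

lemma sum_nweight_step_ancestors:
  assumes "t \<in> {1..T}"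
  shows "(\<Sum>i\<in>{0..N}. nweight t a i * (\<Sum>k\<in>{0..N}. step (Suc t) i k *
      measure_pmf.expectation (ancestors t a i k) (\<lambda>b. f b k))) =
    (if (\<Sum>l\<in>{0..N}. weight t a l) = 0 then 0 else
      measure_pmf.expectation (Pi_pmf {0..N} 0 (\<lambda>_. normalised_pmf {0..N} (weight t a)))
        (\<lambda>b. \<Sum>k\<in>{0..N}. weight (Suc t) b k * f b k))"
proof (cases "(\<Sum>l\<in>{0..N}. weight t a l) = 0")
  case True
  then show ?thesis by (simp add: nweight_def)
next
  case False
  define p where "p = normalised_pmf {0..N} (weight t a)"
  note w = weight_nonneg[OF assms, of a]
  have pos: "0 < (\<Sum>l\<in>{0..N}. weight t a l)"
    using False sum_nonneg[of "{0..N}" "weight t a", OF w] by linarith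
  have nw: "nweight t a i = pmf p i" if "i \<in> {0..N}" for i
    using that by (simp add: p_def nweight_def pmf_normalised_pmf[of "{0..N}" "weight t a", OF _ w pos])
  have sub: "set_pmf p \<subseteq> {0..N}"
    unfolding p_def by (rule set_normalised_pmf_subset) (use w pos in auto)
  have fin: "finite (set_pmf (Pi_pmf {0..N} 0 (\<lambda>_. p)))"
    using finite_subset[OF sub] by (auto simp: set_Pi_pmf intro!: finite_PiE_dflt)
  have "(\<Sum>i\<in>{0..N}. nweight t a i * (\<Sum>k\<in>{0..N}. step (Suc t) i k *
      measure_pmf.expectation (ancestors t a i k) (\<lambda>b. f b k))) =
    (\<Sum>k\<in>{0..N}. \<Sum>i\<in>{0..N}. pmf p i * (step (Suc t) i k *
      measure_pmf.expectation (ancestors t a i k) (\<lambda>b. f b k)))"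
    by (subst sum.swap) (simp only: nw sum_distrib_left cong: sum.cong)
  also have "\<dots> = (\<Sum>k\<in>{0..N}.
      measure_pmf.expectation (Pi_pmf {0..N} 0 (\<lambda>_. p)) (\<lambda>b. step (Suc t) (b k) k * f b k))"
    unfolding ancestors_def p_def[symmetric]
    by (intro sum.cong refl expectation_Pi_pmf_condition_coordinate[where F = "\<lambda>i. step (Suc t) i _"])
       (use sub in auto)
  also have "\<dots> = measure_pmf.expectation (Pi_pmf {0..N} 0 (\<lambda>_. p))
      (\<lambda>b. \<Sum>k\<in>{0..N}. step (Suc t) (b k) k * f b k)"
    by (intro Bochner_Integration.integral_sum[symmetric] integrable_measure_pmf_finite fin)
  \<comment> \<open>As \<open>t\<close> is at least 1, \<open>weight (Suc t)\<close> is in its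
    transition case, not the initial one.\<close>
  also have "\<dots> = measure_pmf.expectation (Pi_pmf {0..N} 0 (\<lambda>_. p))
      (\<lambda>b. \<Sum>k\<in>{0..N}. weight (Suc t) b k * f b k)"
    using assms by (cases t) (auto simp only: weight_Suc_Suc atLeastAtMost_iff)
  finally show ?thesis
    using False by (simp only: p_def if_False)
qed

text \<open>Given the ancestors, the reference index is distributed according to the normalised
  weights. In the induction, resampling at the previous time makes \<open>h\<close> enter only
  through its weighted sum over \<open>k\<close>, which is unchanged when \<open>h\<close> is
  replaced by its weighted mean.\<close>

lemma joint_sum_resample:
  assumes "n < T"
  shows "joint_sum n h = joint_sum n (\<lambda>A _. \<Sum>k\<in>{0..N}. nweight (Suc n) (A n) k * h A k)"
proof -
  have w: "(\<Sum>i\<in>{0..N}. weight (Suc n) a i * (\<Sum>k\<in>{0..N}. nweight (Suc n) a k * h k)) =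
      (\<Sum>k\<in>{0..N}. weight (Suc n) a k * h k)" if "n < T" for a n and h :: "nat \<Rightarrow> real"
    unfolding sum_distrib_right[symmetric] nweight_def
    by (rule sum_normalised_weights) (use that in \<open>auto intro!: weight_nonneg\<close>)
  show ?thesis
    using assms
  proof (induction n arbitrary: h)
    case 0
    then show ?case
      using w[OF 0, of "\<lambda>_. 0"] by simp
  next
    case (Suc n)
    then have "Suc n \<in> {1..T}" "n < T" by auto
    then show ?case
      unfolding joint_sum.simps
      by (subst (1 2) Suc.IH)
         (simp_all only: sum_nweight_step_ancestors fun_upd_same w[OF Suc.prems])
  qed
qed

text \<open>The last index of the path is peeled off: it contributes one \<open>step\<close> to the
  path weight and fixes the forced slot of the last ancestor vector. Both are absorbed into the
  integrand, so the bound \<open>B\<close> has to vary in the induction.\<close>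

lemma sum_path_weight_resampling:
  assumes "\<And>A i. i \<in> {0..N} \<Longrightarrow> \<bar>h A i\<bar> \<le> B"
  shows "(\<Sum>j\<in>index_paths N (Suc n). path_weight (Suc n) j *
      measure_pmf.expectation (resampling m1 m G N z j n) (\<lambda>A. h A (j (Suc n)))) = joint_sum n h"
  using assms
proof (induction n arbitrary: h B)
  case 0
  show ?case
    by (simp add: sum_index_paths_Suc path_weight_1[of _ "\<lambda>_. 0"]) (simp add: index_paths_def)
next
  case (Suc n)
  define g where "g k A i = measure_pmf.expectation (ancestors (Suc n) (A n) i k) (\<lambda>a. h (A(Suc n := a)) k)"
    for k A i
  have B: "0 \<le> B"
    using Suc.prems[of 0 undefined] by auto
  have g: "\<bar>g k A i\<bar> \<le> B" if "k \<in> {0..N}" for k A i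
    unfolding g_def by (rule abs_expectation_le) (rule Suc.prems[OF that])
  have R: "measure_pmf.expectation (resampling m1 m G N z (j(Suc (Suc n) := k)) (Suc n)) (\<lambda>A. h A k) =
      measure_pmf.expectation (resampling m1 m G N z j n) (\<lambda>A. g k A (j (Suc n)))"
    if "k \<in> {0..N}" for j k
  proof -
    have "resampling m1 m G N z (j(Suc (Suc n) := k)) n = resampling m1 m G N z j n"
      by (rule resampling_cong) auto
    then show ?thesis
      using Suc.prems[OF that]
      by (simp add: expectation_bind_pmf_bounded[where B = B] g_def ancestors_def cong: if_cong)
  qed
  have "(\<Sum>j\<in>index_paths N (Suc (Suc n)). path_weight (Suc (Suc n)) j *
      measure_pmf.expectation (resampling m1 m G N z j (Suc n)) (\<lambda>A. h A (j (Suc (Suc n))))) =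
    (\<Sum>j\<in>index_paths N (Suc n). \<Sum>k\<in>{0..N}. path_weight (Suc n) j *
      (step (Suc (Suc n)) (j (Suc n)) k *
       measure_pmf.expectation (resampling m1 m G N z j n) (\<lambda>A. g k A (j (Suc n)))))"
    unfolding sum_index_paths_Suc[of _ _ "Suc n"]
    by (intro sum.cong refl)
       (simp only: path_weight_Suc path_weight_upd fun_upd_same R, simp)
  also have "\<dots> = (\<Sum>j\<in>index_paths N (Suc n). path_weight (Suc n) j *
      measure_pmf.expectation (resampling m1 m G N z j n)
        (\<lambda>A. \<Sum>k\<in>{0..N}. step (Suc (Suc n)) (j (Suc n)) k * g k A (j (Suc n))))"
  proof (intro sum.cong refl)
    fix j
    have "integrable (measure_pmf (resampling m1 m G N z j n)) (\<lambda>A. g k A (j (Suc n)))"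
      if "k \<in> {0..N}" for k
      using g[OF that] by (intro measure_pmf.integrable_const_bound[where B = B]) auto
    then show "(\<Sum>k\<in>{0..N}. path_weight (Suc n) j * (step (Suc (Suc n)) (j (Suc n)) k *
        measure_pmf.expectation (resampling m1 m G N z j n) (\<lambda>A. g k A (j (Suc n))))) =
      path_weight (Suc n) j * measure_pmf.expectation (resampling m1 m G N z j n)
        (\<lambda>A. \<Sum>k\<in>{0..N}. step (Suc (Suc n)) (j (Suc n)) k * g k A (j (Suc n)))"
      by (simp add: sum_distrib_left)
  qed
  also have "\<dots> = joint_sum n (\<lambda>A i. \<Sum>k\<in>{0..N}. step (Suc (Suc n)) i k * g k A i)"
  proof (rule Suc.IH)
    fix A i
    assume i: "i \<in> {0..N}"
    have "\<bar>\<Sum>k\<in>{0..N}. step (Suc (Suc n)) i k * g k A i\<bar> \<le>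
        (\<Sum>k\<in>{0..N}. \<bar>step (Suc (Suc n)) i k\<bar> * B)"
      by (rule order_trans[OF sum_abs])
         (auto simp: abs_mult intro!: sum_mono mult_left_mono g)
    \<comment> \<open>Summing over all \<open>i\<close> makes the bound uniform in
      \<open>i\<close>.\<close>
    also have "\<dots> \<le> (\<Sum>i\<in>{0..N}. \<Sum>k\<in>{0..N}. \<bar>step (Suc (Suc n)) i k\<bar> * B)"
      using i B by (intro member_le_sum[of i "{0..N}"
        "\<lambda>i. \<Sum>k\<in>{0..N}. \<bar>step (Suc (Suc n)) i k\<bar> * B"]) (auto intro!: sum_nonneg)
    finally show "\<bar>\<Sum>k\<in>{0..N}. step (Suc (Suc n)) i k * g k A i\<bar> \<le>
        (\<Sum>i\<in>{0..N}. \<Sum>k\<in>{0..N}. \<bar>step (Suc (Suc n)) i k\<bar> * B)" .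
  qed
  finally show ?case
    by (simp add: g_def)
qed

section \<open>Backward sampling and invariance of the path weights\<close>

text \<open>Integrating out the latest ancestors leaves a transition factor that cancels the
  normalising constant of the backward draw. The draw then becomes an indicator on the reference
  index one time earlier, at the price of one factor of the path weight.\<close>

lemma joint_sum_backward_sampling:
  assumes "n < T" and "\<And>t. t \<in> {1..Suc n} \<Longrightarrow> x t \<in> {0..N}"
  shows "joint_sum n (\<lambda>A i. if i = x (Suc n) then pmf (backward_sampling m1 m G N z A n x) x else 0) =
    path_weight (Suc n) x"
  using assms
proof (induction n)
  case 0
  have "x (Suc 0) \<le> N"
    using 0(2)[of "Suc 0"] by simp
  then show ?case
    by (simp add: path_weight_1[of _ "\<lambda>_. 0"] if_distrib cong: if_cong)
next
  case (Suc n)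
  define b where "b = (\<lambda>n A. pmf (backward_sampling m1 m G N z A n x) x)"
  define M where "M = (\<lambda>i. step (Suc (Suc n)) i (x (Suc (Suc n))))"
  have x: "x (Suc n) \<in> {0..N}" "x (Suc (Suc n)) \<in> {0..N}"
    using Suc.prems(2) by auto
  \<comment> \<open>Backward draws from time \<open>Suc n\<close> on read ancestors up to time
    \<open>n\<close> only, so the ancestors at time \<open>Suc n\<close> integrate out.\<close>
  have b_upd: "b (Suc n) (A(Suc n := a)) = b (Suc n) A" for A a
    unfolding b_def
    by (rule arg_cong[where f = "\<lambda>p. pmf p x"], rule backward_sampling_cong) auto
  have key: "(\<Sum>i\<in>{0..N}. nweight (Suc n) (A n) i * (M i * b (Suc n) A)) =
      (\<Sum>i\<in>{0..N}. nweight (Suc n) (A n) i * (M (x (Suc n)) * (if i = x (Suc n) then b n A else 0)))"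
    for A
  proof -
    define g where "g = G (Suc (Suc n)) (z (Suc (Suc n)) (x (Suc (Suc n))))"
    define v where "v i = weight (Suc n) (A n) i *
      m (Suc n + 1) (z (Suc n) i) (z (Suc n + 1) (x (Suc n + 1)))" for i
    define S where "S = (\<Sum>l\<in>{0..N}. weight (Suc n) (A n) l)"
    have v: "0 \<le> v i" for i
      using Suc.prems(1) unfolding v_def by (intro mult_nonneg_nonneg weight_nonneg m_nonneg) auto
    \<comment> \<open>\<open>v\<close> is the weight of the backward draw; the remaining factor
      \<open>g / S\<close> does not depend on \<open>i\<close>.\<close>
    have vM: "nweight (Suc n) (A n) i * M i = v i * (g / S)" for i
      by (simp add: nweight_def M_def v_def step_def g_def S_def)
    have "(\<Sum>i\<in>{0..N}. v i) * b (Suc n) A =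
        v (x (Suc n)) * pmf (backward_sampling m1 m G N z A n (x(Suc n := x (Suc n)))) x"
      unfolding b_def backward_sampling.simps v_def[symmetric]
      by (rule pmf_bind_normalised_pmf_single) (use v x in \<open>auto intro!: pmf_backward_sampling_eq_0[of "Suc n"]\<close>)
    then have "(\<Sum>i\<in>{0..N}. v i) * b (Suc n) A = v (x (Suc n)) * b n A"
      by (simp add: b_def)
    moreover have "(\<Sum>i\<in>{0..N}. nweight (Suc n) (A n) i * (M i * b (Suc n) A)) =
        (\<Sum>i\<in>{0..N}. v i) * b (Suc n) A * (g / S)"
      unfolding mult.assoc[symmetric] vM sum_distrib_right
      by (intro sum.cong refl) (simp only: mult_ac)
    ultimately have "(\<Sum>i\<in>{0..N}. nweight (Suc n) (A n) i * (M i * b (Suc n) A)) =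
        v (x (Suc n)) * b n A * (g / S)"
      by simp
    also have "\<dots> = nweight (Suc n) (A n) (x (Suc n)) * (M (x (Suc n)) * b n A)"
      using vM[of "x (Suc n)"] by (simp add: mult_ac)
    finally show ?thesis
      using x by (simp add: if_distrib cong: if_cong)
  qed
  have "joint_sum (Suc n) (\<lambda>A i. if i = x (Suc (Suc n)) then b (Suc n) A else 0) =
      joint_sum n (\<lambda>A i. M i * b (Suc n) A)"
    using x by (simp add: b_upd M_def if_distrib cong: if_cong)
  \<comment> \<open>Resampling the index \<open>i\<close> on both sides reduces the equality to
    \<open>key\<close>.\<close>
  also have "\<dots> = joint_sum n (\<lambda>A i. M (x (Suc n)) * (if i = x (Suc n) then b n A else 0))"
    using Suc.prems(1)
    by (subst (1 2) joint_sum_resample) (auto simp only: key)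
  also have "\<dots> = path_weight (Suc (Suc n)) x"
    unfolding joint_sum_mult b_def by (subst Suc.IH) (use Suc.prems in \<open>auto simp: M_def path_weight_Suc\<close>)
  finally show ?case
    unfolding b_def .
qed

text \<open>Given the ancestors, the reference index at time \<open>T\<close> and the selected index
  have the same law. The final draw can therefore be traded for the indicator that the reference
  index is \<open>x T\<close>, which leaves \<open>joint_sum_backward_sampling\<close>.\<close>

lemma path_weight_invariant:
  assumes "1 \<le> T" and x: "x \<in> index_paths N T"
  shows "(\<Sum>j\<in>index_paths N T. path_weight T j * pmf (csmc_backward_kernel m1 m G N T z j) x) =
    path_weight T x"
proof -
  obtain n where T: "T = Suc n"
    using assms(1) by (cases T) auto
  define b where "b = (\<lambda>A. pmf (backward_sampling m1 m G N z A n x) x)"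
  define c where "c = (\<lambda>A. pmf (bind_pmf (normalised_pmf {0..N} (weight T (A n))) (\<lambda>k.
     backward_sampling m1 m G N z A n ((\<lambda>_. undefined)(T := k)))) x)"
  have xI: "x t \<in> {0..N}" if "t \<in> {1..Suc n}" for t
    using x that unfolding index_paths_def T by (rule PiE_mem)
  have xT: "x T \<in> {0..N}"
    by (rule xI) (simp add: T)
  have key: "(\<Sum>k\<in>{0..N}. nweight (Suc n) (A n) k * c A) =
      (\<Sum>k\<in>{0..N}. nweight (Suc n) (A n) k * (if k = x T then b A else 0))" for A
  proof -
    \<comment> \<open>Outside \<open>{1..T}\<close> the path \<open>x\<close> agrees with the
      initial value \<open>undefined\<close> of the sampler, so backward sampling may be started
      from \<open>x\<close> itself.\<close>
    have "x t = undefined" if "t \<notin> {1..Suc n}" for t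
      using x that unfolding index_paths_def T by (rule PiE_arb)
    then have b: "b A = pmf (backward_sampling m1 m G N z A n ((\<lambda>_. undefined)(T := x T))) x"
      unfolding b_def
      by (intro arg_cong[where f = "\<lambda>p. pmf p x"] backward_sampling_cong) (auto simp: T)
    have "(\<Sum>k\<in>{0..N}. weight T (A n) k) * c A = weight T (A n) (x T) * b A"
      unfolding c_def b
      by (rule pmf_bind_normalised_pmf_single)
         (use xT assms(1) in \<open>auto simp: T intro!: weight_nonneg pmf_backward_sampling_eq_0[of T]\<close>)
    then show ?thesis
      using xT
      by (simp add: nweight_def T if_distrib sum_distrib_right[symmetric] sum_divide_distrib[symmetric]
          cong: if_cong)
  qed
  have "(\<Sum>j\<in>index_paths N T. path_weight T j * pmf (csmc_backward_kernel m1 m G N T z j) x) =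
      (\<Sum>j\<in>index_paths N (Suc n). path_weight (Suc n) j *
        measure_pmf.expectation (resampling m1 m G N z j n) c)"
    unfolding csmc_backward_kernel_def c_def by (subst pmf_bind) (simp add: T)
  also have "\<dots> = joint_sum n (\<lambda>A _. c A)"
    by (rule sum_path_weight_resampling[where B = 1 and h = "\<lambda>A _. c A"]) (simp add: c_def pmf_le_1)
  also have "\<dots> = joint_sum n (\<lambda>A i. if i = x T then b A else 0)"
    using T by (subst (1 2) joint_sum_resample) (auto simp only: key)
  also have "\<dots> = path_weight T x"
    unfolding b_def T by (rule joint_sum_backward_sampling) (use T xI in auto)
  finally show ?thesis .
qed

end

section \<open>Normalisation, and reference paths of probability zero\<close>

theorem proposition4p2:
  fixes m1 :: "real^'d \<Rightarrow> real"
    and m :: "nat \<Rightarrow> real^'d \<Rightarrow> real^'d \<Rightarrow> real"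
    and G :: "nat \<Rightarrow> real^'d \<Rightarrow> real"
    and N T :: nat
    and z :: "nat \<Rightarrow> nat \<Rightarrow> real^'d"
    and P :: "(nat \<Rightarrow> nat) \<Rightarrow> (nat \<Rightarrow> nat) pmf"
  assumes "1 \<le> T"
    and "prob_density lborel m1"
    and "\<And>t. t \<in> {2..T} \<Longrightarrow> markov_transition_density (m t)"
    and "\<And>t. t \<in> {1..T} \<Longrightarrow> G t \<in> borel_measurable borel"
    and "\<And>t x. t \<in> {1..T} \<Longrightarrow> 0 < G t x"
    and "prob_density (path_measure T) (target_density m1 m G T)"
    and "0 < (\<Sum>l\<in>index_paths N T. target_density m1 m G T (select_path T z l))"
    and "\<And>j. j \<in> index_paths N T \<Longrightarrow> set_pmf (P j) \<subseteq> index_paths N T"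
    and "\<And>j. j \<in> index_paths N T \<Longrightarrow> 0 < pmf (index_target m1 m G N T z) j \<Longrightarrow>
           P j = csmc_backward_kernel m1 m G N T z j"
  shows "bind_pmf (index_target m1 m G N T z) P = index_target m1 m G N T z"
proof -
  interpret conditional_smc m1 m G N T z
    using assms(2,3,5)
    by unfold_locales (auto simp: prob_density_def markov_transition_density_def less_imp_le)
  let ?I = "index_paths N T"
  define C where "C = (\<integral>y. unnormalised_target m1 m G T y \<partial>path_measure T)"
  have target: "target_density m1 m G T (select_path T z k) = path_weight T k / C" for k
    unfolding target_density_def C_def[symmetric] path_weight_def
    by (rule arg_cong[where f = "\<lambda>u. u / C"], rule unnormalised_target_cong)
       (use assms(1) in \<open>auto simp: select_path_def\<close>)
  have nonneg: "0 \<le> path_weight T k" for k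
    by (rule path_weight_nonneg[OF assms(1)])
  \<comment> \<open>The sign of the integral \<open>C\<close> is read off from the positive total of
    the densities, whose numerator is nonnegative.\<close>
  have pos: "0 < (\<Sum>k\<in>?I. path_weight T k) / C"
    using assms(7) by (simp add: target sum_divide_distrib)
  moreover have "0 \<le> (\<Sum>k\<in>?I. path_weight T k)"
    by (intro sum_nonneg nonneg)
  ultimately have C: "0 < C"
    by (auto simp: zero_less_divide_iff)
  have pmf: "pmf (index_target m1 m G N T z) k =
      (if k \<in> ?I then path_weight T k / (\<Sum>l\<in>?I. path_weight T l) else 0)" for k
    unfolding index_target_def
    by (subst pmf_normalised_pmf)
       (use assms(7) C nonneg in \<open>auto simp: target sum_divide_distrib[symmetric]\<close>)
  have set: "set_pmf (index_target m1 m G N T z) \<subseteq> ?I"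
    by (auto simp: set_pmf_eq pmf split: if_splits)
  show ?thesis
  proof (rule pmf_eqI)
    fix x
    show "pmf (bind_pmf (index_target m1 m G N T z) P) x = pmf (index_target m1 m G N T z) x"
    proof (cases "x \<in> ?I")
      case True
      have "pmf (bind_pmf (index_target m1 m G N T z) P) x =
          (\<Sum>j\<in>?I. pmf (P j) x * pmf (index_target m1 m G N T z) j)"
        unfolding pmf_bind using set by (intro integral_measure_pmf_real) auto
      \<comment> \<open>Where \<open>P\<close> may differ from the algorithm, \<open>j\<close> has
        probability zero and its term vanishes.\<close>
      also have "\<dots> = (\<Sum>j\<in>?I. pmf (csmc_backward_kernel m1 m G N T z j) x *
          pmf (index_target m1 m G N T z) j)"
      proof (intro sum.cong refl)
        fix j
        assume "j \<in> ?I"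
        then show "pmf (P j) x * pmf (index_target m1 m G N T z) j =
            pmf (csmc_backward_kernel m1 m G N T z j) x * pmf (index_target m1 m G N T z) j"
          using assms(9)[of j] pmf_nonneg[of "index_target m1 m G N T z" j]
          by (cases "pmf (index_target m1 m G N T z) j = 0") auto
      qed
      also have "\<dots> = (\<Sum>j\<in>?I. path_weight T j * pmf (csmc_backward_kernel m1 m G N T z j) x) /
          (\<Sum>l\<in>?I. path_weight T l)"
        by (simp add: pmf sum_divide_distrib mult_ac)
      also have "\<dots> = pmf (index_target m1 m G N T z) x"
        using True assms(1) by (simp add: path_weight_invariant pmf)
      finally show ?thesis .
    next
      case False
      have "x \<notin> set_pmf (bind_pmf (index_target m1 m G N T z) P)"
        using set assms(8) False by auto
      then show ?thesis
        unfolding pmf_eq_0_set_pmf[symmetric] using False by (simp only: pmf if_False)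
    qed
  qed
qed

end
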